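(* Let $X$, $T$, $Y$ be $V$-graphs. (i) A choice of unit arrow mappings $*\to 1_a( * )\subset X(a;a)$ in the source $V$-graph $X$ and $*\to 1_s( * )\subset T(s;s)$ in the assistant $V$-graph $T$ defines the name appointment $g: \mathrm{Grph}_V(X\otimes T;Y)\to \mathrm{Grph}_V(X;Y^T)$. (ii) Contact arrows mappings $Y(c;d)\otimes Y(d;e)\to Y(c;d)\circ Y(d;e)\subset Y(c;e)$ in the target $V$-graph $Y$ provide the evaluation transport by precontact arrows mappings and define the realization appointment $f_+: \mathrm{Grph}_V(X;Y^T)\to\mathrm{Grph}_V(X\otimes T;Y)$. (iii) If the contact arrows mappings are monotone, then the composable restriction of these appointments is a joint pair of monotone mappings between the lower decomposable transports $f:X\otimes T\Rightarrow Y$ and the upper neutral transports $g:X\Rightarrow Y^T$; that is, the appointments are monotone and $$f\ \ge\ f_+(g(f))$$ for every $V$-graphs transport $f:X\otimes T\Rightarrow Y$ which is lower decomposable, i.e. such that for all $a,b\in X_0$, $s,t\in T_0$ the mappings $X(a;b)\otimes T(s;t)\to Y(f_0(a,s);f_0(b,t))$ satisfy $$f_{\langle a,s\rangle,\langle b,s\rangle}(X(a;b)\otimes 1_s( * ))\circ f_{\langle b,s\rangle,\langle b,t\rangle}(1_b( * )\otimes T(s;t))\ \le\ f_{\langle a,s\rangle,\langle b,t\rangle}(X(a;b)\otimes T(s;t)),$$ and $$g(f_+(g))\ \ge\ g$$ for every $V$-graphs transport $g:X\Rightarrow Y^T$ which is upper neutral, i.e. such that $$g_{a,b}(X(a;b))_s\circ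 g_0(b)_{s,s}(1_s( * ))\ \ge\ g_{a,b}(X(a;b))_s \quad\text{as mappings } X(a;b)\to Y(g_0(a)_s;g_0(b)_s),$$ $$g_{a,a}(1_a( * ))_s\circ g_0(a)_{s,t}(T(s;t))\ \ge\ g_0(a)_{s,t}(T(s;t))\quad\text{as mappings } T(s;t)\to Y(g_0(a)_s;g_0(a)_t).$$
   Context: $V$ is a category with a bifunctor $\otimes:V\times V\to V$ (called a biproduct; not a categorical biproduct), a final object $*$ that is neutral for it ($*\otimes r\cong r\cong r\otimes *$ naturally), and the products used below. Each set $V(r;s)$ of arrows ("mappings") carries an order relation $\ge$; composition, $\otimes$ (in both arguments) and products of mappings are monotone. A $V$-graph $X$ is a set of vertexes $X_0$ with objects $X(x;y)\in V$. A $V$-graphs transport $f:X\Rightarrow Y$ is a map $f_0:X_0\to Y_0$ with mappings $f_{x,y}:X(x;y)\to Y(f_0(x);f_0(y))$ in $V$ (no further condition); these form the category $\mathrm{Grph}_V$. For mappings, notation like $f_{x,y}(X(x;y))$, $1_a( * )\otimes T(s;t)$, or $A\circ B$ denotes the evident composite mapping with the contact arrows mapping, with $X(a;b)\cong X(a;b)\otimes *$ etc. inserted. If $f_0=f'_0$, then $f\ge f'$ means $f_{x,y}\ge f'_{x,y}$ for all $x,y$. $X\otimes T$ has vertexes $X_0\times T_0$ and edges $X(x;x')\otimes T(s;s')$. $Y^T$ has as vertexes all $V$-graphs transports $\phi:T\Rightarrow Y$ (one writes $\phi(s)=\phi_s=\phi_0(s)$) and edges $Y^T(\phi;\psi)=\prod_{s\in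 T_0}Y(\phi_0(s);\psi_0(s))$; for $u$ into $Y^T(\phi;\psi)$, $u_s$ is its $s$-component. For transports $g,g':X\Rightarrow Y^T$, $g\ge g'$ means: $(g_0(x))_0=(g'_0(x))_0$ for all $x$, $g_0(x)_{s,t}\ge g'_0(x)_{s,t}$ for all $x,s,t$, and $g_{x,y}\ge g'_{x,y}$. Unit arrow mappings are mappings $1_x:*\to X(x;x)$ (no law assumed); contact arrows mappings are mappings $Y(c;d)\otimes Y(d;e)\to Y(c;e)$ (no law assumed). They are monotone if for every $r\in V$ composing a pair in $V(r;Y(c;d))\times V(r';Y(d;e))$ with them is monotone in each argument. Name appointment: $g(f)=\lambda_X$ followed by $f^T$. Explicitly, $g(f)_0(a):T\Rightarrow Y$ sends $s\mapsto f_0(a,s)$ with edge mappings $T(s;t)\to f_{\langle a,s\rangle,\langle a,t\rangle}(1_a( * )\otimes T(s;t))$, and $g(f)_{a,b}$ has $s$-component $X(a;b)\to f_{\langle a,s\rangle,\langle b,s\rangle}(X(a;b)\otimes 1_s( * ))$. Realization: $f_+(g)=(g\otimes\mathrm{Id}_T)$ followed by the evaluation $\mathrm{ev}_Y:Y^T\otimes T\Rightarrow Y$, $(\phi,s)\mapsto\phi_0(s)$, with precontact edge mappings $Y^T(\phi;\psi)\otimes T(s;t)\to Y(\phi_0(s);\psi_0(s))\circ\psi_{s,t}(T(s;t))\subset Y(\phi_0(s);\psi_0(t))$. Explicitly $f_+(g)_0(a,s)=g_0(a)_s$, with edge mappings $X(a;b)\otimes T(s;t)\to g_{a,b}(X(a;b))_s\circ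 g_0(b)_{s,t}(T(s;t))$. "Composable restriction" means that the composites are considered where both partial appointments are defined with the stated properties. *)

theory Defs
  imports Main "HOL-Library.FuncSet"
begin

section \<open>Ordered categories with a biproduct\<close>

text \<open>Composition is written in the classical order: \<open>g \<odot> f\<close> is \<open>f\<close> followed by \<open>g\<close>.
  The order is only meaningful between mappings with the same source and the same target.
  The type \<open>'i\<close> indexes the families whose products \<open>prd\<close>, with projections \<open>prj\<close>, are chosen.
  No product is assumed to exist here; see \<open>has_power\<close> below.\<close>

record ('o, 'm, 'i) vcat =
  obj :: "'o set"
  arr :: "'m set"
  src :: "'m \<Rightarrow> 'o"
  tgt :: "'m \<Rightarrow> 'o"
  ide :: "'o \<Rightarrow> 'm"
  cmp :: "'m \<Rightarrow> 'm \<Rightarrow> 'm"  (infixr "\<odot>\<index>" 70)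
  le :: "'m \<Rightarrow> 'm \<Rightarrow> bool"  (infix "\<sqsubseteq>\<index>" 50)
  tob :: "'o \<Rightarrow> 'o \<Rightarrow> 'o"  (infixr "\<boxtimes>\<index>" 75)
  tar :: "'m \<Rightarrow> 'm \<Rightarrow> 'm"  (infixr "\<otimes>\<index>" 75)
  fin :: "'o"  ("\<star>\<index>")
  lun :: "'o \<Rightarrow> 'm"
  run :: "'o \<Rightarrow> 'm"
  prd :: "'i set \<Rightarrow> ('i \<Rightarrow> 'o) \<Rightarrow> 'o"
  prj :: "'i set \<Rightarrow> ('i \<Rightarrow> 'o) \<Rightarrow> 'i \<Rightarrow> 'm"

definition hom :: "('o, 'm, 'i) vcat \<Rightarrow> 'o \<Rightarrow> 'o \<Rightarrow> 'm set" where
  "hom V r s = {f \<in> arr V. src V f = r \<and> tgt V f = s}"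

definition is_iso :: "('o, 'm, 'i) vcat \<Rightarrow> 'o \<Rightarrow> 'o \<Rightarrow> 'm \<Rightarrow> bool" where
  "is_iso V r s f \<longleftrightarrow> f \<in> hom V r s \<and>
     (\<exists>g \<in> hom V s r. g \<odot>\<^bsub>V\<^esub> f = ide V r \<and> f \<odot>\<^bsub>V\<^esub> g = ide V s)"

definition is_product ::
    "('o, 'm, 'i) vcat \<Rightarrow> 'i set \<Rightarrow> ('i \<Rightarrow> 'o) \<Rightarrow> 'o \<Rightarrow> ('i \<Rightarrow> 'm) \<Rightarrow> bool" where
  "is_product V I A p pr \<longleftrightarrow> p \<in> obj V \<and> (\<forall>i\<in>I. pr i \<in> hom V p (A i)) \<and>
     (\<forall>r\<in>obj V. \<forall>u. (\<forall>i\<in>I. u i \<in> hom V r (A i)) \<longrightarrow>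
        (\<exists>!h. h \<in> hom V r p \<and> (\<forall>i\<in>I. pr i \<odot>\<^bsub>V\<^esub> h = u i)))"

text \<open>In the locale below, \<open>prod_mono\<close> says that the mapping \<open>r \<rightarrow> \<Prod>\<^sub>i A\<^sub>i\<close> with given
  components depends monotonically on these components.  With \<open>cmp_mono\<close> it gives the
  monotonicity of \<open>\<Prod>\<^sub>i f\<^sub>i : \<Prod>\<^sub>i A\<^sub>i \<rightarrow> \<Prod>\<^sub>i B\<^sub>i\<close> in the \<open>f\<^sub>i\<close>.\<close>

locale ordered_tensor_category =
  fixes V :: "('o, 'm, 'i) vcat" (structure)
  assumes src_tgt: "f \<in> arr V \<Longrightarrow> src V f \<in> obj V \<and> tgt V f \<in> obj V"
    and ide_hom: "r \<in> obj V \<Longrightarrow> ide V r \<in> hom V r r"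
    and cmp_hom: "f \<in> hom V r s \<Longrightarrow> g \<in> hom V s t \<Longrightarrow> g \<odot> f \<in> hom V r t"
    and cmp_ide_right: "f \<in> hom V r s \<Longrightarrow> f \<odot> ide V r = f"
    and cmp_ide_left: "f \<in> hom V r s \<Longrightarrow> ide V s \<odot> f = f"
    and cmp_assoc: "f \<in> hom V r s \<Longrightarrow> g \<in> hom V s t \<Longrightarrow> h \<in> hom V t w \<Longrightarrow>
          (h \<odot> g) \<odot> f = h \<odot> (g \<odot> f)"
    and tob_obj: "r \<in> obj V \<Longrightarrow> s \<in> obj V \<Longrightarrow> r \<boxtimes> s \<in> obj V"
    and tar_hom: "f \<in> hom V r s \<Longrightarrow> f' \<in> hom V r' s' \<Longrightarrow> f \<otimes> f' \<in> hom V (r \<boxtimes> r') (s \<boxtimes> s')"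
    and tar_ide: "r \<in> obj V \<Longrightarrow> s \<in> obj V \<Longrightarrow> ide V r \<otimes> ide V s = ide V (r \<boxtimes> s)"
    and tar_cmp: "f \<in> hom V r s \<Longrightarrow> g \<in> hom V s t \<Longrightarrow> f' \<in> hom V r' s' \<Longrightarrow> g' \<in> hom V s' t' \<Longrightarrow>
          (g \<odot> f) \<otimes> (g' \<odot> f') = (g \<otimes> g') \<odot> (f \<otimes> f')"
    and fin_obj: "\<star> \<in> obj V"
    and fin_final: "r \<in> obj V \<Longrightarrow> \<exists>!f. f \<in> hom V r \<star>"
    and lun_iso: "r \<in> obj V \<Longrightarrow> is_iso V r (\<star> \<boxtimes> r) (lun V r)"
    and lun_natural: "f \<in> hom V r s \<Longrightarrow> lun V s \<odot> f = (ide V \<star> \<otimes> f) \<odot> lun V r"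
    and run_iso: "r \<in> obj V \<Longrightarrow> is_iso V r (r \<boxtimes> \<star>) (run V r)"
    and run_natural: "f \<in> hom V r s \<Longrightarrow> run V s \<odot> f = (f \<otimes> ide V \<star>) \<odot> run V r"
    and le_order: "r \<in> obj V \<Longrightarrow> s \<in> obj V \<Longrightarrow>
          partial_order_on (hom V r s) {(f, g). f \<in> hom V r s \<and> g \<in> hom V r s \<and> f \<sqsubseteq> g}"
    and cmp_mono: "f \<in> hom V r s \<Longrightarrow> f' \<in> hom V r s \<Longrightarrow> g \<in> hom V s t \<Longrightarrow> g' \<in> hom V s t \<Longrightarrow>
          f \<sqsubseteq> f' \<Longrightarrow> g \<sqsubseteq> g' \<Longrightarrow> g \<odot> f \<sqsubseteq> g' \<odot> f'"
    and tar_mono: "f \<in> hom V r s \<Longrightarrow> f' \<in> hom V r s \<Longrightarrow> g \<in> hom V t w \<Longrightarrow> g' \<in> hom V t w \<Longrightarrow>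
          f \<sqsubseteq> f' \<Longrightarrow> g \<sqsubseteq> g' \<Longrightarrow> f \<otimes> g \<sqsubseteq> f' \<otimes> g'"
    and prod_mono: "is_product V I A p pr \<Longrightarrow> u \<in> hom V r p \<Longrightarrow> v \<in> hom V r p \<Longrightarrow>
          (\<And>i. i \<in> I \<Longrightarrow> pr i \<odot> u \<sqsubseteq> pr i \<odot> v) \<Longrightarrow> u \<sqsubseteq> v"

text \<open>The mapping from \<open>r\<close> into the chosen product with components \<open>u i\<close>.\<close>

definition tuple ::
    "('o, 'm, 'i) vcat \<Rightarrow> 'i set \<Rightarrow> ('i \<Rightarrow> 'o) \<Rightarrow> 'o \<Rightarrow> ('i \<Rightarrow> 'm) \<Rightarrow> 'm" where
  "tuple V I A r u =
     (THE h. h \<in> hom V r (prd V I A) \<and> (\<forall>i\<in>I. prj V I A i \<odot>\<^bsub>V\<^esub> h = u i))"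


section \<open>Graphs over V and their transports\<close>

record ('x, 'o) vgraph =
  vset :: "'x set"
  eobj :: "'x \<Rightarrow> 'x \<Rightarrow> 'o"

definition is_vgraph :: "('o, 'm, 'i) vcat \<Rightarrow> ('x, 'o) vgraph \<Rightarrow> bool" where
  "is_vgraph V X \<longleftrightarrow> (\<forall>x\<in>vset X. \<forall>y\<in>vset X. eobj X x y \<in> obj V)"

datatype ('x, 'y, 'm) transport = Transport (vmap: "'x \<Rightarrow> 'y") (emap: "'x \<times> 'x \<Rightarrow> 'm")

text \<open>Both components are extensional, so that equality of transports is the intended one
  (transports are the vertexes of the power graph below).\<close>

definition transports ::
    "('o, 'm, 'i) vcat \<Rightarrow> ('x, 'o) vgraph \<Rightarrow> ('y, 'o) vgraph \<Rightarrow> ('x, 'y, 'm) transport set" where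
  "transports V X Y = {f. vmap f \<in> vset X \<rightarrow>\<^sub>E vset Y \<and>
     emap f \<in> (\<Pi>\<^sub>E (x, y)\<in>vset X \<times> vset X. hom V (eobj X x y) (eobj Y (vmap f x) (vmap f y)))}"

definition transport_le ::
    "('o, 'm, 'i) vcat \<Rightarrow> ('x, 'o) vgraph \<Rightarrow> ('x, 'y, 'm) transport \<Rightarrow> ('x, 'y, 'm) transport \<Rightarrow> bool"
  where
  "transport_le V X f f' \<longleftrightarrow> (\<forall>x\<in>vset X. vmap f x = vmap f' x) \<and>
     (\<forall>x\<in>vset X. \<forall>y\<in>vset X. emap f (x, y) \<sqsubseteq>\<^bsub>V\<^esub> emap f' (x, y))"

definition id_transport :: "('o, 'm, 'i) vcat \<Rightarrow> ('x, 'o) vgraph \<Rightarrow> ('x, 'x, 'm) transport" where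
  "id_transport V X = Transport (\<lambda>x\<in>vset X. x) (\<lambda>(x, y)\<in>vset X \<times> vset X. ide V (eobj X x y))"

text \<open>\<open>followed_by V X f g\<close> is \<open>f : X \<Rightarrow> Y\<close> followed by \<open>g : Y \<Rightarrow> Z\<close>.\<close>

definition followed_by ::
    "('o, 'm, 'i) vcat \<Rightarrow> ('x, 'o) vgraph \<Rightarrow> ('x, 'y, 'm) transport \<Rightarrow> ('y, 'z, 'm) transport
      \<Rightarrow> ('x, 'z, 'm) transport" where
  "followed_by V X f g = Transport (\<lambda>x\<in>vset X. vmap g (vmap f x))
     (\<lambda>(x, y)\<in>vset X \<times> vset X. emap g (vmap f x, vmap f y) \<odot>\<^bsub>V\<^esub> emap f (x, y))"

definition tgraph ::
    "('o, 'm, 'i) vcat \<Rightarrow> ('x, 'o) vgraph \<Rightarrow> ('t, 'o) vgraph \<Rightarrow> ('x \<times> 't, 'o) vgraph" where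
  "tgraph V X T = \<lparr>vset = vset X \<times> vset T,
     eobj = (\<lambda>(x, s) (y, t). eobj X x y \<boxtimes>\<^bsub>V\<^esub> eobj T s t)\<rparr>"

definition tensor_transport ::
    "('o, 'm, 'i) vcat \<Rightarrow> ('x, 'o) vgraph \<Rightarrow> ('t, 'o) vgraph \<Rightarrow> ('x, 'y, 'm) transport
      \<Rightarrow> ('t, 'w, 'm) transport \<Rightarrow> ('x \<times> 't, 'y \<times> 'w, 'm) transport" where
  "tensor_transport V X T f h = Transport
     (\<lambda>(x, s)\<in>vset X \<times> vset T. (vmap f x, vmap h s))
     (\<lambda>((x, s), (y, t))\<in>(vset X \<times> vset T) \<times> (vset X \<times> vset T). emap f (x, y) \<otimes>\<^bsub>V\<^esub> emap h (s, t))"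


section \<open>Power graphs\<close>

definition pow_family :: "('t, 'o) vgraph \<Rightarrow> ('y, 'o) vgraph \<Rightarrow> ('t, 'y, 'm) transport
    \<Rightarrow> ('t, 'y, 'm) transport \<Rightarrow> 't \<Rightarrow> 'o" where
  "pow_family T Y \<phi> \<psi> = (\<lambda>s\<in>vset T. eobj Y (vmap \<phi> s) (vmap \<psi> s))"

definition pgraph :: "('o, 'm, 't) vcat \<Rightarrow> ('t, 'o) vgraph \<Rightarrow> ('y, 'o) vgraph
    \<Rightarrow> (('t, 'y, 'm) transport, 'o) vgraph" where
  "pgraph V T Y = \<lparr>vset = transports V T Y,
     eobj = (\<lambda>\<phi> \<psi>. prd V (vset T) (pow_family T Y \<phi> \<psi>))\<rparr>"

definition has_power :: "('o, 'm, 't) vcat \<Rightarrow> ('t, 'o) vgraph \<Rightarrow> ('y, 'o) vgraph \<Rightarrow> bool" where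
  "has_power V T Y \<longleftrightarrow> (\<forall>\<phi>\<in>transports V T Y. \<forall>\<psi>\<in>transports V T Y.
     is_product V (vset T) (pow_family T Y \<phi> \<psi>)
       (prd V (vset T) (pow_family T Y \<phi> \<psi>)) (prj V (vset T) (pow_family T Y \<phi> \<psi>)))"

text \<open>The component \<open>u\<^sub>s\<close> of a mapping \<open>u\<close> into the edge object of the power graph
  from \<open>\<phi>\<close> to \<open>\<psi>\<close>.\<close>

definition component :: "('o, 'm, 't) vcat \<Rightarrow> ('t, 'o) vgraph \<Rightarrow> ('y, 'o) vgraph
    \<Rightarrow> ('t, 'y, 'm) transport \<Rightarrow> ('t, 'y, 'm) transport \<Rightarrow> 't \<Rightarrow> 'm \<Rightarrow> 'm" where
  "component V T Y \<phi> \<psi> s u = prj V (vset T) (pow_family T Y \<phi> \<psi>) s \<odot>\<^bsub>V\<^esub> u"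

definition power_transport_le :: "('o, 'm, 't) vcat \<Rightarrow> ('x, 'o) vgraph \<Rightarrow> ('t, 'o) vgraph
    \<Rightarrow> ('x, ('t, 'y, 'm) transport, 'm) transport \<Rightarrow> ('x, ('t, 'y, 'm) transport, 'm) transport \<Rightarrow> bool"
  where
  "power_transport_le V X T g g' \<longleftrightarrow>
     (\<forall>x\<in>vset X. \<forall>s\<in>vset T. vmap (vmap g x) s = vmap (vmap g' x) s) \<and>
     (\<forall>x\<in>vset X. \<forall>s\<in>vset T. \<forall>t\<in>vset T. emap (vmap g x) (s, t) \<sqsubseteq>\<^bsub>V\<^esub> emap (vmap g' x) (s, t)) \<and>
     (\<forall>x\<in>vset X. \<forall>y\<in>vset X. emap g (x, y) \<sqsubseteq>\<^bsub>V\<^esub> emap g' (x, y))"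


section \<open>Unit and contact arrows mappings\<close>

definition unit_arrows :: "('o, 'm, 'i) vcat \<Rightarrow> ('x, 'o) vgraph \<Rightarrow> ('x \<Rightarrow> 'm) \<Rightarrow> bool" where
  "unit_arrows V X e \<longleftrightarrow> (\<forall>x\<in>vset X. e x \<in> hom V \<star>\<^bsub>V\<^esub> (eobj X x x))"

definition contact_arrows ::
    "('o, 'm, 'i) vcat \<Rightarrow> ('y, 'o) vgraph \<Rightarrow> ('y \<Rightarrow> 'y \<Rightarrow> 'y \<Rightarrow> 'm) \<Rightarrow> bool" where
  "contact_arrows V Y k \<longleftrightarrow> (\<forall>c\<in>vset Y. \<forall>d\<in>vset Y. \<forall>e\<in>vset Y.
     k c d e \<in> hom V (eobj Y c d \<boxtimes>\<^bsub>V\<^esub> eobj Y d e) (eobj Y c e))"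

text \<open>For \<open>u : r \<rightarrow> Y(c;d)\<close> and \<open>v : r' \<rightarrow> Y(d;e)\<close>, the mapping
  \<open>u(r) \<circ> v(r') : r \<otimes> r' \<rightarrow> Y(c;e)\<close>.\<close>

definition contact :: "('o, 'm, 'i) vcat \<Rightarrow> ('y \<Rightarrow> 'y \<Rightarrow> 'y \<Rightarrow> 'm) \<Rightarrow> 'y \<Rightarrow> 'y \<Rightarrow> 'y
    \<Rightarrow> 'm \<Rightarrow> 'm \<Rightarrow> 'm" where
  "contact V k c d e u v = k c d e \<odot>\<^bsub>V\<^esub> (u \<otimes>\<^bsub>V\<^esub> v)"

definition monotone_contact ::
    "('o, 'm, 'i) vcat \<Rightarrow> ('y, 'o) vgraph \<Rightarrow> ('y \<Rightarrow> 'y \<Rightarrow> 'y \<Rightarrow> 'm) \<Rightarrow> bool" where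
  "monotone_contact V Y k \<longleftrightarrow> (\<forall>c\<in>vset Y. \<forall>d\<in>vset Y. \<forall>e\<in>vset Y. \<forall>r\<in>obj V. \<forall>r'\<in>obj V.
     (\<forall>v \<in> hom V r' (eobj Y d e).
        monotone_on (hom V r (eobj Y c d)) (le V) (le V) (\<lambda>u. contact V k c d e u v)) \<and>
     (\<forall>u \<in> hom V r (eobj Y c d).
        monotone_on (hom V r' (eobj Y d e)) (le V) (le V) (\<lambda>v. contact V k c d e u v)))"


section \<open>Name appointment\<close>

text \<open>\<open>unit_left V T e a s t\<close> is \<open>T(s;t) \<cong> * \<otimes> T(s;t) \<rightarrow> X(a;a) \<otimes> T(s;t)\<close>, that is
  \<open>1\<^sub>a(*) \<otimes> T(s;t)\<close>, and \<open>unit_right V X e a b s\<close> is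
  \<open>X(a;b) \<cong> X(a;b) \<otimes> * \<rightarrow> X(a;b) \<otimes> T(s;s)\<close>, that is \<open>X(a;b) \<otimes> 1\<^sub>s(*)\<close>.\<close>

definition unit_left :: "('o, 'm, 'i) vcat \<Rightarrow> ('t, 'o) vgraph \<Rightarrow> ('x \<Rightarrow> 'm) \<Rightarrow> 'x \<Rightarrow> 't \<Rightarrow> 't \<Rightarrow> 'm" where
  "unit_left V T e a s t = (e a \<otimes>\<^bsub>V\<^esub> ide V (eobj T s t)) \<odot>\<^bsub>V\<^esub> lun V (eobj T s t)"

definition unit_right :: "('o, 'm, 'i) vcat \<Rightarrow> ('x, 'o) vgraph \<Rightarrow> ('t \<Rightarrow> 'm) \<Rightarrow> 'x \<Rightarrow> 'x \<Rightarrow> 't \<Rightarrow> 'm" where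
  "unit_right V X e a b s = (ide V (eobj X a b) \<otimes>\<^bsub>V\<^esub> e s) \<odot>\<^bsub>V\<^esub> run V (eobj X a b)"

definition name_at :: "('o, 'm, 't) vcat \<Rightarrow> ('t, 'o) vgraph \<Rightarrow> ('x \<Rightarrow> 'm)
    \<Rightarrow> ('x \<times> 't, 'y, 'm) transport \<Rightarrow> 'x \<Rightarrow> ('t, 'y, 'm) transport" where
  "name_at V T eX f a = Transport (\<lambda>s\<in>vset T. vmap f (a, s))
     (\<lambda>(s, t)\<in>vset T \<times> vset T. emap f ((a, s), (a, t)) \<odot>\<^bsub>V\<^esub> unit_left V T eX a s t)"

definition name_appointment :: "('o, 'm, 't) vcat \<Rightarrow> ('x, 'o) vgraph \<Rightarrow> ('t, 'o) vgraph
    \<Rightarrow> ('y, 'o) vgraph \<Rightarrow> ('x \<Rightarrow> 'm) \<Rightarrow> ('t \<Rightarrow> 'm) \<Rightarrow> ('x \<times> 't, 'y, 'm) transport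
    \<Rightarrow> ('x, ('t, 'y, 'm) transport, 'm) transport" where
  "name_appointment V X T Y eX eT f = Transport (\<lambda>a\<in>vset X. name_at V T eX f a)
     (\<lambda>(a, b)\<in>vset X \<times> vset X.
        tuple V (vset T) (pow_family T Y (name_at V T eX f a) (name_at V T eX f b)) (eobj X a b)
          (\<lambda>s. emap f ((a, s), (b, s)) \<odot>\<^bsub>V\<^esub> unit_right V X eT a b s))"

text \<open>\<open>lambda_transport\<close> is \<open>\<lambda>\<^sub>X : X \<Rightarrow> (X \<otimes> T)\<^sup>T\<close> and \<open>power_transport\<close> is
  \<open>f\<^sup>T : Z\<^sup>T \<Rightarrow> Y\<^sup>T\<close> for \<open>f : Z \<Rightarrow> Y\<close>.  Lemma \<open>name_appointment_eq\<close> below shows that, as soon as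
  the products defining \<open>(X \<otimes> T)\<^sup>T\<close> exist, the name appointment is \<open>\<lambda>\<^sub>X\<close> followed
  by \<open>f\<^sup>T\<close>.\<close>

definition lambda_at :: "('o, 'm, 't) vcat \<Rightarrow> ('t, 'o) vgraph \<Rightarrow> ('x \<Rightarrow> 'm) \<Rightarrow> 'x
    \<Rightarrow> ('t, 'x \<times> 't, 'm) transport" where
  "lambda_at V T eX a = Transport (\<lambda>s\<in>vset T. (a, s))
     (\<lambda>(s, t)\<in>vset T \<times> vset T. unit_left V T eX a s t)"

definition lambda_transport :: "('o, 'm, 't) vcat \<Rightarrow> ('x, 'o) vgraph \<Rightarrow> ('t, 'o) vgraph
    \<Rightarrow> ('x \<Rightarrow> 'm) \<Rightarrow> ('t \<Rightarrow> 'm) \<Rightarrow> ('x, ('t, 'x \<times> 't, 'm) transport, 'm) transport" where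
  "lambda_transport V X T eX eT = Transport (\<lambda>a\<in>vset X. lambda_at V T eX a)
     (\<lambda>(a, b)\<in>vset X \<times> vset X.
        tuple V (vset T) (pow_family T (tgraph V X T) (lambda_at V T eX a) (lambda_at V T eX b))
          (eobj X a b) (\<lambda>s. unit_right V X eT a b s))"

definition power_transport :: "('o, 'm, 't) vcat \<Rightarrow> ('t, 'o) vgraph \<Rightarrow> ('z, 'o) vgraph
    \<Rightarrow> ('y, 'o) vgraph \<Rightarrow> ('z, 'y, 'm) transport
    \<Rightarrow> (('t, 'z, 'm) transport, ('t, 'y, 'm) transport, 'm) transport" where
  "power_transport V T Z Y f = Transport (\<lambda>\<phi>\<in>transports V T Z. followed_by V T \<phi> f)
     (\<lambda>(\<phi>, \<psi>)\<in>transports V T Z \<times> transports V T Z.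
        tuple V (vset T) (pow_family T Y (followed_by V T \<phi> f) (followed_by V T \<psi> f))
          (prd V (vset T) (pow_family T Z \<phi> \<psi>))
          (\<lambda>s. emap f (vmap \<phi> s, vmap \<psi> s) \<odot>\<^bsub>V\<^esub> prj V (vset T) (pow_family T Z \<phi> \<psi>) s))"


section \<open>Evaluation and realization appointment\<close>

definition evaluation :: "('o, 'm, 't) vcat \<Rightarrow> ('t, 'o) vgraph \<Rightarrow> ('y, 'o) vgraph
    \<Rightarrow> ('y \<Rightarrow> 'y \<Rightarrow> 'y \<Rightarrow> 'm) \<Rightarrow> (('t, 'y, 'm) transport \<times> 't, 'y, 'm) transport" where
  "evaluation V T Y k = Transport
     (\<lambda>(\<phi>, s)\<in>transports V T Y \<times> vset T. vmap \<phi> s)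
     (\<lambda>((\<phi>, s), (\<psi>, t))\<in>(transports V T Y \<times> vset T) \<times> (transports V T Y \<times> vset T).
        contact V k (vmap \<phi> s) (vmap \<psi> s) (vmap \<psi> t)
          (prj V (vset T) (pow_family T Y \<phi> \<psi>) s) (emap \<psi> (s, t)))"

definition realization_appointment :: "('o, 'm, 't) vcat \<Rightarrow> ('x, 'o) vgraph \<Rightarrow> ('t, 'o) vgraph
    \<Rightarrow> ('y, 'o) vgraph \<Rightarrow> ('y \<Rightarrow> 'y \<Rightarrow> 'y \<Rightarrow> 'm)
    \<Rightarrow> ('x, ('t, 'y, 'm) transport, 'm) transport \<Rightarrow> ('x \<times> 't, 'y, 'm) transport" where
  "realization_appointment V X T Y k g =
     followed_by V (tgraph V X T) (tensor_transport V X T g (id_transport V T)) (evaluation V T Y k)"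


section \<open>Lower decomposable and upper neutral transports\<close>

definition lower_decomposable :: "('o, 'm, 't) vcat \<Rightarrow> ('x, 'o) vgraph \<Rightarrow> ('t, 'o) vgraph
    \<Rightarrow> ('y, 'o) vgraph \<Rightarrow> ('x \<Rightarrow> 'm) \<Rightarrow> ('t \<Rightarrow> 'm) \<Rightarrow> ('y \<Rightarrow> 'y \<Rightarrow> 'y \<Rightarrow> 'm)
    \<Rightarrow> ('x \<times> 't, 'y, 'm) transport set" where
  "lower_decomposable V X T Y eX eT k = {f \<in> transports V (tgraph V X T) Y.
     \<forall>a\<in>vset X. \<forall>b\<in>vset X. \<forall>s\<in>vset T. \<forall>t\<in>vset T.
       contact V k (vmap f (a, s)) (vmap f (b, s)) (vmap f (b, t))
         (emap f ((a, s), (b, s)) \<odot>\<^bsub>V\<^esub> unit_right V X eT a b s)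
         (emap f ((b, s), (b, t)) \<odot>\<^bsub>V\<^esub> unit_left V T eX b s t)
       \<sqsubseteq>\<^bsub>V\<^esub> emap f ((a, s), (b, t))}"

definition upper_neutral :: "('o, 'm, 't) vcat \<Rightarrow> ('x, 'o) vgraph \<Rightarrow> ('t, 'o) vgraph
    \<Rightarrow> ('y, 'o) vgraph \<Rightarrow> ('x \<Rightarrow> 'm) \<Rightarrow> ('t \<Rightarrow> 'm) \<Rightarrow> ('y \<Rightarrow> 'y \<Rightarrow> 'y \<Rightarrow> 'm)
    \<Rightarrow> ('x, ('t, 'y, 'm) transport, 'm) transport set" where
  "upper_neutral V X T Y eX eT k = {g \<in> transports V X (pgraph V T Y).
     (\<forall>a\<in>vset X. \<forall>b\<in>vset X. \<forall>s\<in>vset T.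
        component V T Y (vmap g a) (vmap g b) s (emap g (a, b))
        \<sqsubseteq>\<^bsub>V\<^esub>
        contact V k (vmap (vmap g a) s) (vmap (vmap g b) s) (vmap (vmap g b) s)
          (component V T Y (vmap g a) (vmap g b) s (emap g (a, b)))
          (emap (vmap g b) (s, s) \<odot>\<^bsub>V\<^esub> eT s) \<odot>\<^bsub>V\<^esub> run V (eobj X a b)) \<and>
     (\<forall>a\<in>vset X. \<forall>s\<in>vset T. \<forall>t\<in>vset T.
        emap (vmap g a) (s, t)
        \<sqsubseteq>\<^bsub>V\<^esub>
        contact V k (vmap (vmap g a) s) (vmap (vmap g a) s) (vmap (vmap g a) t)
          (component V T Y (vmap g a) (vmap g a) s (emap g (a, a) \<odot>\<^bsub>V\<^esub> eX a))
          (emap (vmap g a) (s, t)) \<odot>\<^bsub>V\<^esub> lun V (eobj T s t))}"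


section \<open>Comparison of the two forms of each appointment\<close>

lemma transportsI:
  assumes "\<And>x. x \<in> vset X \<Longrightarrow> F x \<in> vset Y"
    and "\<And>x y. x \<in> vset X \<Longrightarrow> y \<in> vset X \<Longrightarrow> E (x, y) \<in> hom V (eobj X x y) (eobj Y (F x) (F y))"
  shows "Transport (restrict F (vset X)) (restrict E (vset X \<times> vset X)) \<in> transports V X Y"
  using assms by (auto simp: transports_def)

lemma transports_vmap: "f \<in> transports V X Y \<Longrightarrow> x \<in> vset X \<Longrightarrow> vmap f x \<in> vset Y"
  by (auto simp: transports_def)

lemma transports_emap:
  "f \<in> transports V X Y \<Longrightarrow> x \<in> vset X \<Longrightarrow> y \<in> vset X \<Longrightarrow>
    emap f (x, y) \<in> hom V (eobj X x y) (eobj Y (vmap f x) (vmap f y))"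
  by (fastforce simp: transports_def PiE_def Pi_def)

lemma transport_eqI:
  assumes "f \<in> transports V X Y" "g \<in> transports V X Y"
    and "\<And>x. x \<in> vset X \<Longrightarrow> vmap f x = vmap g x"
    and "\<And>x y. x \<in> vset X \<Longrightarrow> y \<in> vset X \<Longrightarrow> emap f (x, y) = emap g (x, y)"
  shows "f = g"
proof (rule transport.expand, intro conjI)
  show "vmap f = vmap g"
    using assms(1-3) by (intro extensionalityI[where A = "vset X"]) (auto simp: transports_def PiE_def)
  show "emap f = emap g"
    using assms(1,2,4)
    by (intro extensionalityI[where A = "vset X \<times> vset X"]) (auto simp: transports_def PiE_def)
qed

lemma is_vgraph_obj: "is_vgraph V X \<Longrightarrow> x \<in> vset X \<Longrightarrow> y \<in> vset X \<Longrightarrow> eobj X x y \<in> obj V"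
  by (simp add: is_vgraph_def)

lemma tgraph_simps [simp]:
  "vset (tgraph V X T) = vset X \<times> vset T"
  "eobj (tgraph V X T) (x, s) (y, t) = eobj X x y \<boxtimes>\<^bsub>V\<^esub> eobj T s t"
  by (simp_all add: tgraph_def)

lemma pgraph_simps [simp]:
  "vset (pgraph V T Y) = transports V T Y"
  "eobj (pgraph V T Y) \<phi> \<psi> = prd V (vset T) (pow_family T Y \<phi> \<psi>)"
  by (simp_all add: pgraph_def)

context ordered_tensor_category
begin

lemma hom_obj: "f \<in> hom V r s \<Longrightarrow> r \<in> obj V \<and> s \<in> obj V"
  using src_tgt by (auto simp: hom_def)

lemma tuple_ex1:
  assumes "is_product V I A (prd V I A) (prj V I A)" "r \<in> obj V" "\<And>i. i \<in> I \<Longrightarrow> u i \<in> hom V r (A i)"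
  shows "\<exists>!h. h \<in> hom V r (prd V I A) \<and> (\<forall>i\<in>I. prj V I A i \<odot> h = u i)"
  using assms unfolding is_product_def by blast

lemma tuple_hom:
  assumes "is_product V I A (prd V I A) (prj V I A)" "r \<in> obj V" "\<And>i. i \<in> I \<Longrightarrow> u i \<in> hom V r (A i)"
  shows "tuple V I A r u \<in> hom V r (prd V I A)"
  using theI'[OF tuple_ex1[OF assms]] unfolding tuple_def by blast

lemma prj_tuple:
  assumes "is_product V I A (prd V I A) (prj V I A)" "r \<in> obj V" "\<And>i. i \<in> I \<Longrightarrow> u i \<in> hom V r (A i)"
    and "i \<in> I"
  shows "prj V I A i \<odot> tuple V I A r u = u i"
  using theI'[OF tuple_ex1[OF assms(1-3)]] assms(4) unfolding tuple_def by blast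

lemma tuple_unique:
  assumes "is_product V I A (prd V I A) (prj V I A)" "r \<in> obj V" "\<And>i. i \<in> I \<Longrightarrow> u i \<in> hom V r (A i)"
    and "h \<in> hom V r (prd V I A)" "\<And>i. i \<in> I \<Longrightarrow> prj V I A i \<odot> h = u i"
  shows "tuple V I A r u = h"
  unfolding tuple_def by (rule the1_equality[OF tuple_ex1[OF assms(1-3)]]) (use assms(4,5) in auto)

lemma has_powerD:
  "has_power V T Y \<Longrightarrow> \<phi> \<in> transports V T Y \<Longrightarrow> \<psi> \<in> transports V T Y \<Longrightarrow>
    is_product V (vset T) (pow_family T Y \<phi> \<psi>)
       (prd V (vset T) (pow_family T Y \<phi> \<psi>)) (prj V (vset T) (pow_family T Y \<phi> \<psi>))"
  by (simp add: has_power_def)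

lemma prj_hom:
  assumes "has_power V T Y" "\<phi> \<in> transports V T Y" "\<psi> \<in> transports V T Y" "s \<in> vset T"
  shows "prj V (vset T) (pow_family T Y \<phi> \<psi>) s
     \<in> hom V (prd V (vset T) (pow_family T Y \<phi> \<psi>)) (eobj Y (vmap \<phi> s) (vmap \<psi> s))"
proof -
  have "pow_family T Y \<phi> \<psi> s = eobj Y (vmap \<phi> s) (vmap \<psi> s)"
    using assms(4) by (simp add: pow_family_def)
  with has_powerD[OF assms(1-3)] assms(4) show ?thesis
    unfolding is_product_def by metis
qed

lemma unit_left_hom:
  assumes "is_vgraph V T" "unit_arrows V X eX" "a \<in> vset X" "s \<in> vset T" "t \<in> vset T"
  shows "unit_left V T eX a s t \<in> hom V (eobj T s t) (eobj X a a \<boxtimes> eobj T s t)"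
  using assms lun_iso ide_hom unfolding unit_left_def is_iso_def
  by (auto intro!: cmp_hom tar_hom is_vgraph_obj simp: unit_arrows_def)

lemma unit_right_hom:
  assumes "is_vgraph V X" "unit_arrows V T eT" "a \<in> vset X" "b \<in> vset X" "s \<in> vset T"
  shows "unit_right V X eT a b s \<in> hom V (eobj X a b) (eobj X a b \<boxtimes> eobj T s s)"
  using assms run_iso ide_hom unfolding unit_right_def is_iso_def
  by (auto intro!: cmp_hom tar_hom is_vgraph_obj simp: unit_arrows_def)

lemma followed_by_transports:
  assumes "f \<in> transports V X Y" "g \<in> transports V Y Z"
  shows "followed_by V X f g \<in> transports V X Z"
  unfolding followed_by_def
proof (rule transportsI, goal_cases)
  case (1 x)
  then show ?case using assms transports_vmap by metis
next
  case (2 x y)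
  then show ?case using assms by (auto intro!: cmp_hom transports_emap transports_vmap)
qed

lemma name_at_transports:
  assumes "is_vgraph V T" "unit_arrows V X eX" "f \<in> transports V (tgraph V X T) Y" "a \<in> vset X"
  shows "name_at V T eX f a \<in> transports V T Y"
  unfolding name_at_def
proof (rule transportsI, goal_cases)
  case (1 s)
  then show ?case using transports_vmap[OF assms(3)] assms(4) by simp
next
  case (2 s t)
  then show ?case
    using transports_emap[OF assms(3), of "(a, s)" "(a, t)"] unit_left_hom[OF assms(1,2,4)] assms(4)
    by (auto intro!: cmp_hom)
qed

lemma lambda_at_transports:
  assumes "is_vgraph V T" "unit_arrows V X eX" "a \<in> vset X"
  shows "lambda_at V T eX a \<in> transports V T (tgraph V X T)"
  unfolding lambda_at_def
proof (rule transportsI, goal_cases)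
  case (1 s)
  then show ?case using assms by simp
next
  case (2 s t)
  then show ?case using unit_left_hom[OF assms] by auto
qed

lemma lambda_at_followed_by:
  assumes "a \<in> vset X"
  shows "followed_by V T (lambda_at V T eX a) f = name_at V T eX f a"
  unfolding followed_by_def lambda_at_def name_at_def by (auto intro!: restrict_ext)

lemma name_edge_hom:
  assumes "is_vgraph V X" "unit_arrows V T eT" "f \<in> transports V (tgraph V X T) Y"
    and "a \<in> vset X" "b \<in> vset X" "s \<in> vset T"
  shows "emap f ((a, s), (b, s)) \<odot> unit_right V X eT a b s
    \<in> hom V (eobj X a b) (eobj Y (vmap f (a, s)) (vmap f (b, s)))"
  using transports_emap[OF assms(3), of "(a, s)" "(b, s)"] unit_right_hom[OF assms(1,2,4-6)] assms(4-6)
  by (auto intro!: cmp_hom)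

lemma name_edge_family:
  assumes "is_vgraph V X" "unit_arrows V T eT" "f \<in> transports V (tgraph V X T) Y"
    and "a \<in> vset X" "b \<in> vset X" "s \<in> vset T"
  shows "emap f ((a, s), (b, s)) \<odot> unit_right V X eT a b s
    \<in> hom V (eobj X a b) (pow_family T Y (name_at V T eX f a) (name_at V T eX f b) s)"
  using name_edge_hom[OF assms] assms(6) by (simp add: pow_family_def name_at_def)

lemma lambda_transport_transports:
  assumes "is_vgraph V X" "is_vgraph V T" "has_power V T (tgraph V X T)"
    and "unit_arrows V X eX" "unit_arrows V T eT"
  shows "lambda_transport V X T eX eT \<in> transports V X (pgraph V T (tgraph V X T))"
  unfolding lambda_transport_def
proof (rule transportsI, goal_cases)
  case (1 x)
  then show ?case using lambda_at_transports[OF assms(2,4)] by simp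
next
  case (2 a b)
  have "unit_right V X eT a b s \<in> hom V (eobj X a b)
      (pow_family T (tgraph V X T) (lambda_at V T eX a) (lambda_at V T eX b) s)" if "s \<in> vset T" for s
    using unit_right_hom[OF assms(1,5) 2 that] that by (simp add: pow_family_def lambda_at_def)
  then show ?case
    using 2 lambda_at_transports[OF assms(2,4)] assms(1)
    by (auto intro!: tuple_hom has_powerD[OF assms(3)] is_vgraph_obj)
qed

lemma power_edge_family:
  assumes "has_power V T Z" "f \<in> transports V Z Y"
    and "\<phi> \<in> transports V T Z" "\<psi> \<in> transports V T Z" "s \<in> vset T"
  shows "emap f (vmap \<phi> s, vmap \<psi> s) \<odot> prj V (vset T) (pow_family T Z \<phi> \<psi>) s
    \<in> hom V (prd V (vset T) (pow_family T Z \<phi> \<psi>))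
        (pow_family T Y (followed_by V T \<phi> f) (followed_by V T \<psi> f) s)"
  using prj_hom[OF assms(1,3-5)] transports_emap[OF assms(2)] transports_vmap[OF assms(3,5)]
    transports_vmap[OF assms(4,5)] assms(5)
  by (auto intro!: cmp_hom simp: pow_family_def followed_by_def)

lemma power_transport_transports:
  assumes "has_power V T Z" "has_power V T Y" "f \<in> transports V Z Y"
  shows "power_transport V T Z Y f \<in> transports V (pgraph V T Z) (pgraph V T Y)"
proof -
  have obj: "prd V (vset T) (pow_family T Z \<phi> \<psi>) \<in> obj V"
    if "\<phi> \<in> transports V T Z" "\<psi> \<in> transports V T Z" for \<phi> \<psi>
    using has_powerD[OF assms(1) that] by (simp add: is_product_def)
  have "power_transport V T Z Y f = Transport
     (restrict (\<lambda>\<phi>. followed_by V T \<phi> f) (vset (pgraph V T Z)))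
     (restrict (\<lambda>(\<phi>, \<psi>). tuple V (vset T) (pow_family T Y (followed_by V T \<phi> f) (followed_by V T \<psi> f))
          (prd V (vset T) (pow_family T Z \<phi> \<psi>))
          (\<lambda>s. emap f (vmap \<phi> s, vmap \<psi> s) \<odot> prj V (vset T) (pow_family T Z \<phi> \<psi>) s))
       (vset (pgraph V T Z) \<times> vset (pgraph V T Z)))"
    by (simp add: power_transport_def)
  also have "\<dots> \<in> transports V (pgraph V T Z) (pgraph V T Y)"
    using assms obj power_edge_family[OF assms(1,3)]
    by (intro transportsI)
      (auto intro!: tuple_hom has_powerD[OF assms(2)] followed_by_transports[OF _ assms(3)])
  finally show ?thesis .
qed

lemma name_appointment_transports:
  assumes "is_vgraph V X" "is_vgraph V T" "has_power V T Y"
    and "unit_arrows V X eX" "unit_arrows V T eT" "f \<in> transports V (tgraph V X T) Y"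
  shows "name_appointment V X T Y eX eT f \<in> transports V X (pgraph V T Y)"
  unfolding name_appointment_def
proof (rule transportsI, goal_cases)
  case (1 x)
  then show ?case using name_at_transports[OF assms(2,4,6)] by simp
next
  case (2 a b)
  then show ?case
    using name_at_transports[OF assms(2,4,6)] name_edge_family[OF assms(1,5,6) 2] assms(1)
    by (auto intro!: tuple_hom has_powerD[OF assms(3)] is_vgraph_obj)
qed

lemma name_appointment_eq:
  assumes "is_vgraph V X" "is_vgraph V T" "has_power V T Y" "has_power V T (tgraph V X T)"
    and "unit_arrows V X eX" "unit_arrows V T eT" "f \<in> transports V (tgraph V X T) Y"
  shows "name_appointment V X T Y eX eT f =
    followed_by V X (lambda_transport V X T eX eT) (power_transport V T (tgraph V X T) Y f)"
proof (rule transport_eqI)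
  let ?l = "lambda_at V T eX" and ?n = "name_at V T eX f" and ?Z = "tgraph V X T"
  show "name_appointment V X T Y eX eT f \<in> transports V X (pgraph V T Y)"
    by (rule name_appointment_transports[OF assms(1-3,5-7)])
  show "followed_by V X (lambda_transport V X T eX eT) (power_transport V T ?Z Y f)
      \<in> transports V X (pgraph V T Y)"
    by (rule followed_by_transports[OF lambda_transport_transports[OF assms(1,2,4-6)]
          power_transport_transports[OF assms(4,3,7)]])
  have l: "?l a \<in> transports V T ?Z" if "a \<in> vset X" for a
    by (rule lambda_at_transports[OF assms(2,5) that])
  have ln: "followed_by V T (?l a) f = ?n a" if "a \<in> vset X" for a
    by (rule lambda_at_followed_by[OF that])
  fix a
  assume a: "a \<in> vset X"
  show "vmap (name_appointment V X T Y eX eT f) a =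
      vmap (followed_by V X (lambda_transport V X T eX eT) (power_transport V T ?Z Y f)) a"
    using a l ln
    by (simp add: name_appointment_def followed_by_def[of _ X] lambda_transport_def power_transport_def)
  fix b
  assume b: "b \<in> vset X"
  let ?P = "pow_family T ?Z (?l a) (?l b)" and ?Q = "pow_family T Y (?n a) (?n b)"
  let ?u = "\<lambda>s. unit_right V X eT a b s"
  let ?w = "\<lambda>s. emap f (vmap (?l a) s, vmap (?l b) s) \<odot> prj V (vset T) ?P s"
  have P: "is_product V (vset T) ?P (prd V (vset T) ?P) (prj V (vset T) ?P)"
    by (rule has_powerD[OF assms(4) l[OF a] l[OF b]])
  have n: "?n c \<in> transports V T Y" if "c \<in> vset X" for c
    by (rule name_at_transports[OF assms(2,5,7) that])
  have Q: "is_product V (vset T) ?Q (prd V (vset T) ?Q) (prj V (vset T) ?Q)"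
    by (rule has_powerD[OF assms(3) n[OF a] n[OF b]])
  have r: "eobj X a b \<in> obj V" by (rule is_vgraph_obj[OF assms(1) a b])
  have Po: "prd V (vset T) ?P \<in> obj V" using P by (simp add: is_product_def)
  have u: "?u s \<in> hom V (eobj X a b) (?P s)" if "s \<in> vset T" for s
    using unit_right_hom[OF assms(1,6) a b that] that by (simp add: pow_family_def lambda_at_def)
  have w: "?w s \<in> hom V (prd V (vset T) ?P) (?Q s)" if "s \<in> vset T" for s
    using power_edge_family[OF assms(4,7) l[OF a] l[OF b] that] ln a b by simp
  have pQ: "prj V (vset T) ?Q s \<in> hom V (prd V (vset T) ?Q) (?Q s)" if "s \<in> vset T" for s
    using Q that by (simp add: is_product_def)
  have pP: "prj V (vset T) ?P s \<in> hom V (prd V (vset T) ?P) (?P s)" if "s \<in> vset T" for s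
    using P that by (simp add: is_product_def)
  have tu: "tuple V (vset T) ?P (eobj X a b) ?u \<in> hom V (eobj X a b) (prd V (vset T) ?P)"
    by (rule tuple_hom[OF P r u])
  have tw: "tuple V (vset T) ?Q (prd V (vset T) ?P) ?w \<in> hom V (prd V (vset T) ?P) (prd V (vset T) ?Q)"
    by (rule tuple_hom[OF Q Po w])
  have "tuple V (vset T) ?Q (eobj X a b) (\<lambda>s. emap f ((a, s), (b, s)) \<odot> ?u s) =
      tuple V (vset T) ?Q (prd V (vset T) ?P) ?w \<odot> tuple V (vset T) ?P (eobj X a b) ?u"
  proof (rule tuple_unique[OF Q r])
    fix s
    assume s: "s \<in> vset T"
    show "emap f ((a, s), (b, s)) \<odot> ?u s \<in> hom V (eobj X a b) (?Q s)"
      by (rule name_edge_family[OF assms(1,6,7) a b s])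
    have e: "emap f ((a, s), (b, s)) \<in> hom V (?P s) (?Q s)"
      using transports_emap[OF assms(7), of "(a, s)" "(b, s)"] a b s
      by (simp add: pow_family_def lambda_at_def name_at_def)
    have "prj V (vset T) ?Q s \<odot> tuple V (vset T) ?Q (prd V (vset T) ?P) ?w
        \<odot> tuple V (vset T) ?P (eobj X a b) ?u = ?w s \<odot> tuple V (vset T) ?P (eobj X a b) ?u"
      using cmp_assoc[OF tu tw pQ[OF s]] prj_tuple[OF Q Po w s] by simp
    also have "\<dots> = emap f ((a, s), (b, s)) \<odot> ?u s"
      using cmp_assoc[OF tu pP[OF s] e] prj_tuple[OF P r u s] s by (simp add: lambda_at_def)
    finally show "prj V (vset T) ?Q s \<odot> tuple V (vset T) ?Q (prd V (vset T) ?P) ?w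
        \<odot> tuple V (vset T) ?P (eobj X a b) ?u = emap f ((a, s), (b, s)) \<odot> ?u s" .
  qed (rule cmp_hom[OF tu tw])
  then show "emap (name_appointment V X T Y eX eT f) (a, b) =
      emap (followed_by V X (lambda_transport V X T eX eT) (power_transport V T ?Z Y f)) (a, b)"
    using a b l ln
    by (simp add: name_appointment_def followed_by_def[of _ X] lambda_transport_def power_transport_def)
qed

lemma realization_vmap:
  assumes "g \<in> transports V X (pgraph V T Y)" "a \<in> vset X" "s \<in> vset T"
  shows "vmap (realization_appointment V X T Y k g) (a, s) = vmap (vmap g a) s"
  using assms transports_vmap[OF assms(1)]
  by (simp add: realization_appointment_def followed_by_def evaluation_def tensor_transport_def
      id_transport_def)

lemma realization_emap:
  assumes "is_vgraph V T" "has_power V T Y" "contact_arrows V Y k"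
    and "g \<in> transports V X (pgraph V T Y)"
    and "a \<in> vset X" "b \<in> vset X" "s \<in> vset T" "t \<in> vset T"
  shows "emap (realization_appointment V X T Y k g) ((a, s), (b, t)) =
    contact V k (vmap (vmap g a) s) (vmap (vmap g b) s) (vmap (vmap g b) t)
      (component V T Y (vmap g a) (vmap g b) s (emap g (a, b))) (emap (vmap g b) (s, t))"
proof -
  let ?\<phi> = "vmap g a" and ?\<psi> = "vmap g b"
  have ga: "?\<phi> \<in> transports V T Y" and gb: "?\<psi> \<in> transports V T Y"
    using transports_vmap[OF assms(4)] assms(5,6) by simp_all
  have e: "emap g (a, b) \<in> hom V (eobj X a b) (prd V (vset T) (pow_family T Y ?\<phi> ?\<psi>))"
    using transports_emap[OF assms(4-6)] by simp
  note p = prj_hom[OF assms(2) ga gb assms(7)]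
  note f = transports_emap[OF gb assms(7,8)]
  have i: "ide V (eobj T s t) \<in> hom V (eobj T s t) (eobj T s t)"
    by (rule ide_hom[OF is_vgraph_obj[OF assms(1,7,8)]])
  have k: "k (vmap ?\<phi> s) (vmap ?\<psi> s) (vmap ?\<psi> t)
      \<in> hom V (eobj Y (vmap ?\<phi> s) (vmap ?\<psi> s) \<boxtimes> eobj Y (vmap ?\<psi> s) (vmap ?\<psi> t))
          (eobj Y (vmap ?\<phi> s) (vmap ?\<psi> t))"
    using assms(3,7,8) transports_vmap[OF ga] transports_vmap[OF gb] by (simp add: contact_arrows_def)
  show ?thesis
    using assms(5-8) ga gb cmp_assoc[OF tar_hom[OF e i] tar_hom[OF p f] k]
      tar_cmp[OF e p i f, symmetric] cmp_ide_right[OF f]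
    by (simp add: realization_appointment_def followed_by_def evaluation_def tensor_transport_def
      id_transport_def contact_def component_def)
qed

end

end

theory Submission
  imports Defs
begin

text \<open>Both appointments are given by formulas built from composition, \<open>\<otimes>\<close> and tupling into a
  product.  The order on mappings is compatible with each of these operations, and so the
  appointments are monotone.

  For the joint pair, both round trips are computed edgewise.  The component at \<open>s\<close> of the edge
  \<open>g(f)\<^sub>a\<^sub>,\<^sub>b\<close> is \<open>f(X(a;b) \<otimes> 1\<^sub>s(*))\<close> (\<open>component_name_appointment\<close>), so the edge of \<open>f\<^sub>+(g(f))\<close>
  from \<open>(a,s)\<close> to \<open>(b,t)\<close> is literally the left-hand side in the definition of a lower decomposable
  transport.  Conversely, precomposing an edge of \<open>f\<^sub>+(g)\<close> with a unit arrow moves, by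
  functoriality of \<open>\<otimes>\<close>, the unit into the corresponding argument of the contact
  (\<open>contact_unit_left\<close>, \<open>contact_unit_right\<close>).  The edges of \<open>T \<Rightarrow> Y\<close> and the components of
  the edges of \<open>X \<Rightarrow> Y\<^sup>T\<close> that make up \<open>g(f\<^sub>+(g))\<close> are thereby the right-hand sides in
  the definition of an upper neutral transport.

  The two transports \<open>g\<close> and \<open>g(f\<^sub>+(g))\<close> send \<open>a\<close> to vertexes of \<open>Y\<^sup>T\<close> that have the same vertex
  map but usually different edge mappings.  Their edges are comparable all the same, because an
  edge object of \<open>Y\<^sup>T\<close> depends only on the vertex maps of its ends (\<open>pow_family_cong\<close>).\<close>

section \<open>The order on mappings\<close>

lemma pow_family_cong:
  assumes "\<And>s. s \<in> vset T \<Longrightarrow> vmap \<phi> s = vmap \<phi>' s" "\<And>s. s \<in> vset T \<Longrightarrow> vmap \<psi> s = vmap \<psi>' s"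
  shows "pow_family T Y \<phi> \<psi> = pow_family T Y \<phi>' \<psi>'"
  unfolding pow_family_def using assms by (intro restrict_ext) simp

context ordered_tensor_category
begin

lemma le_refl: "f \<in> hom V r s \<Longrightarrow> f \<sqsubseteq> f"
  using le_order[of r s] hom_obj[of f r s]
  by (auto simp: partial_order_on_def preorder_on_def refl_on_def)

lemma cmp_mono_left:
  "f \<in> hom V r s \<Longrightarrow> g \<in> hom V s t \<Longrightarrow> g' \<in> hom V s t \<Longrightarrow> g \<sqsubseteq> g' \<Longrightarrow> g \<odot> f \<sqsubseteq> g' \<odot> f"
  by (blast intro: cmp_mono le_refl)

lemma cmp_mono_right:
  "f \<in> hom V r s \<Longrightarrow> f' \<in> hom V r s \<Longrightarrow> g \<in> hom V s t \<Longrightarrow> f \<sqsubseteq> f' \<Longrightarrow> g \<odot> f \<sqsubseteq> g \<odot> f'"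
  by (blast intro: cmp_mono le_refl)

text \<open>Mappings into a product are compared by \<open>prod_mono\<close> through their components, and the
  components of a tuple are known.\<close>

lemma tuple_mono:
  assumes P: "is_product V I A (prd V I A) (prj V I A)" and r: "r \<in> obj V"
    and u: "\<And>i. i \<in> I \<Longrightarrow> u i \<in> hom V r (A i)" and v: "\<And>i. i \<in> I \<Longrightarrow> v i \<in> hom V r (A i)"
    and le: "\<And>i. i \<in> I \<Longrightarrow> u i \<sqsubseteq> v i"
  shows "tuple V I A r u \<sqsubseteq> tuple V I A r v"
proof (rule prod_mono[OF P tuple_hom[OF P r u] tuple_hom[OF P r v]])
  fix i assume "i \<in> I"
  then show "prj V I A i \<odot> tuple V I A r u \<sqsubseteq> prj V I A i \<odot> tuple V I A r v"
    using prj_tuple[where u = u, OF P r u] prj_tuple[where u = v, OF P r v] le by simp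
qed


section \<open>Contact of mappings\<close>

lemma contact_arrowsD:
  "contact_arrows V Y k \<Longrightarrow> c \<in> vset Y \<Longrightarrow> d \<in> vset Y \<Longrightarrow> e \<in> vset Y \<Longrightarrow>
    k c d e \<in> hom V (eobj Y c d \<boxtimes> eobj Y d e) (eobj Y c e)"
  by (simp add: contact_arrows_def)

lemma contact_hom:
  assumes "contact_arrows V Y k" "c \<in> vset Y" "d \<in> vset Y" "e \<in> vset Y"
    and "u \<in> hom V r (eobj Y c d)" "v \<in> hom V r' (eobj Y d e)"
  shows "contact V k c d e u v \<in> hom V (r \<boxtimes> r') (eobj Y c e)"
  unfolding contact_def by (rule cmp_hom[OF tar_hom[OF assms(5,6)] contact_arrowsD[OF assms(1-4)]])

lemma contact_mono:
  assumes "contact_arrows V Y k" "c \<in> vset Y" "d \<in> vset Y" "e \<in> vset Y"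
    and u: "u \<in> hom V r (eobj Y c d)" "u' \<in> hom V r (eobj Y c d)" "u \<sqsubseteq> u'"
    and v: "v \<in> hom V r' (eobj Y d e)" "v' \<in> hom V r' (eobj Y d e)" "v \<sqsubseteq> v'"
  shows "contact V k c d e u v \<sqsubseteq> contact V k c d e u' v'"
  unfolding contact_def
  by (rule cmp_mono_right[OF tar_hom[OF u(1) v(1)] tar_hom[OF u(2) v(2)]
        contact_arrowsD[OF assms(1-4)] tar_mono[OF u(1,2) v(1,2) u(3) v(3)]])

text \<open>This is functoriality of \<open>\<otimes>\<close>; it serves to push unit arrows into one argument of a contact
  while the other argument stays unchanged.\<close>

lemma contact_cmp_tar:
  assumes "contact_arrows V Y k" "c \<in> vset Y" "d \<in> vset Y" "e \<in> vset Y"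
    and u: "u' \<in> hom V q r" "u \<in> hom V r (eobj Y c d)"
    and v: "v' \<in> hom V q' r'" "v \<in> hom V r' (eobj Y d e)"
  shows "contact V k c d e u v \<odot> (u' \<otimes> v') = contact V k c d e (u \<odot> u') (v \<odot> v')"
  unfolding contact_def tar_cmp[OF u v]
  by (rule cmp_assoc[OF tar_hom[OF u(1) v(1)] tar_hom[OF u(2) v(2)] contact_arrowsD[OF assms(1-4)]])

text \<open>The next two lemmas turn the edge mappings of \<open>g(f\<^sub>+(g))\<close>, where the unit arrow comes first and
  the contact last, into the form used to define upper neutral transports, where the unit arrow is
  already absorbed in an argument of the contact.\<close>

lemma contact_unit_left:
  assumes "is_vgraph V T" "unit_arrows V X eX" "contact_arrows V Y k"
    and "c \<in> vset Y" "d \<in> vset Y" "e \<in> vset Y" "a \<in> vset X" "s \<in> vset T" "t \<in> vset T"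
    and u: "u \<in> hom V (eobj X a a) (eobj Y c d)" and v: "v \<in> hom V (eobj T s t) (eobj Y d e)"
  shows "contact V k c d e u v \<odot> unit_left V T eX a s t =
    contact V k c d e (u \<odot> eX a) v \<odot> lun V (eobj T s t)"
proof -
  have T: "eobj T s t \<in> obj V" by (rule is_vgraph_obj[OF assms(1,8,9)])
  note i = ide_hom[OF T]
  have x: "eX a \<in> hom V \<star> (eobj X a a)" using assms(2,7) by (simp add: unit_arrows_def)
  have l: "lun V (eobj T s t) \<in> hom V (eobj T s t) (\<star> \<boxtimes> eobj T s t)"
    using lun_iso[OF T] by (simp add: is_iso_def)
  show ?thesis
    unfolding unit_left_def
      cmp_assoc[OF l tar_hom[OF x i] contact_hom[OF assms(3-6) u v], symmetric]
      contact_cmp_tar[OF assms(3-6) x u i v] cmp_ide_right[OF v] ..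
qed

lemma contact_unit_right:
  assumes "is_vgraph V X" "unit_arrows V T eT" "contact_arrows V Y k"
    and "c \<in> vset Y" "d \<in> vset Y" "e \<in> vset Y" "a \<in> vset X" "b \<in> vset X" "s \<in> vset T"
    and u: "u \<in> hom V (eobj X a b) (eobj Y c d)" and v: "v \<in> hom V (eobj T s s) (eobj Y d e)"
  shows "contact V k c d e u v \<odot> unit_right V X eT a b s =
    contact V k c d e u (v \<odot> eT s) \<odot> run V (eobj X a b)"
proof -
  have X: "eobj X a b \<in> obj V" by (rule is_vgraph_obj[OF assms(1,7,8)])
  note i = ide_hom[OF X]
  have x: "eT s \<in> hom V \<star> (eobj T s s)" using assms(2,9) by (simp add: unit_arrows_def)
  have l: "run V (eobj X a b) \<in> hom V (eobj X a b) (eobj X a b \<boxtimes> \<star>)"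
    using run_iso[OF X] by (simp add: is_iso_def)
  show ?thesis
    unfolding unit_right_def
      cmp_assoc[OF l tar_hom[OF i x] contact_hom[OF assms(3-6) u v], symmetric]
      contact_cmp_tar[OF assms(3-6) i u x v] cmp_ide_right[OF u] ..
qed


section \<open>Evaluation and realization are transports\<close>

lemma id_transport_transports: "is_vgraph V T \<Longrightarrow> id_transport V T \<in> transports V T T"
  unfolding id_transport_def by (rule transportsI) (auto intro: ide_hom is_vgraph_obj)

lemma tensor_transport_transports:
  assumes "f \<in> transports V X Y" "h \<in> transports V T W"
  shows "tensor_transport V X T f h \<in> transports V (tgraph V X T) (tgraph V Y W)"
  unfolding tensor_transport_def tgraph_simps(1)[of V X T, symmetric]
  using assms by (intro transportsI) (auto intro!: tar_hom transports_emap transports_vmap)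

lemma evaluation_transports:
  assumes "has_power V T Y" "contact_arrows V Y k"
  shows "evaluation V T Y k \<in> transports V (tgraph V (pgraph V T Y) T) Y"
proof -
  have "evaluation V T Y k = Transport
     (\<lambda>(\<phi>, s)\<in>vset (tgraph V (pgraph V T Y) T). vmap \<phi> s)
     (\<lambda>((\<phi>, s), (\<psi>, t))\<in>vset (tgraph V (pgraph V T Y) T) \<times> vset (tgraph V (pgraph V T Y) T).
        contact V k (vmap \<phi> s) (vmap \<psi> s) (vmap \<psi> t)
          (prj V (vset T) (pow_family T Y \<phi> \<psi>) s) (emap \<psi> (s, t)))"
    by (simp add: evaluation_def)
  also have "\<dots> \<in> transports V (tgraph V (pgraph V T Y) T) Y"
    by (rule transportsI)
      (auto intro!: contact_hom[OF assms(2)] prj_hom[OF assms(1)] intro: transports_emap transports_vmap)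
  finally show ?thesis .
qed

lemma realization_appointment_transports:
  assumes "is_vgraph V T" "has_power V T Y" "contact_arrows V Y k" "g \<in> transports V X (pgraph V T Y)"
  shows "realization_appointment V X T Y k g \<in> transports V (tgraph V X T) Y"
  unfolding realization_appointment_def
  by (rule followed_by_transports[OF
        tensor_transport_transports[OF assms(4) id_transport_transports[OF assms(1)]]
        evaluation_transports[OF assms(2,3)]])

lemma component_emap_hom:
  assumes "has_power V T Y" "g \<in> transports V X (pgraph V T Y)"
    and "a \<in> vset X" "b \<in> vset X" "s \<in> vset T"
  shows "component V T Y (vmap g a) (vmap g b) s (emap g (a, b))
    \<in> hom V (eobj X a b) (eobj Y (vmap (vmap g a) s) (vmap (vmap g b) s))"
  unfolding component_def
  using cmp_hom[OF transports_emap[OF assms(2-4), simplified]] prj_hom[OF assms(1)]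
    transports_vmap[OF assms(2)] assms(3-5) by simp


section \<open>Monotonicity of the appointments\<close>

lemma name_appointment_mono:
  assumes "is_vgraph V X" "is_vgraph V T" "has_power V T Y"
    and "unit_arrows V X eX" "unit_arrows V T eT"
    and f: "f \<in> transports V (tgraph V X T) Y" and f': "f' \<in> transports V (tgraph V X T) Y"
    and "transport_le V (tgraph V X T) f f'"
  shows "power_transport_le V X T
    (name_appointment V X T Y eX eT f) (name_appointment V X T Y eX eT f')"
proof -
  let ?n = "name_at V T eX f" and ?n' = "name_at V T eX f'"
  have v: "vmap f (a, s) = vmap f' (a, s)" if "a \<in> vset X" "s \<in> vset T" for a s
    using assms(8) that by (simp add: transport_le_def)
  have e: "emap f ((a, s), (b, t)) \<sqsubseteq> emap f' ((a, s), (b, t))"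
    if "a \<in> vset X" "s \<in> vset T" "b \<in> vset X" "t \<in> vset T" for a s b t
    using assms(8) that by (simp add: transport_le_def)
  have h: "emap f ((a, s), (b, t)) \<in> hom V (eobj X a b \<boxtimes> eobj T s t) (eobj Y (vmap f (a, s)) (vmap f (b, t)))"
    and h': "emap f' ((a, s), (b, t)) \<in> hom V (eobj X a b \<boxtimes> eobj T s t) (eobj Y (vmap f (a, s)) (vmap f (b, t)))"
    if "a \<in> vset X" "s \<in> vset T" "b \<in> vset X" "t \<in> vset T" for a s b t
    using transports_emap[OF f, of "(a, s)" "(b, t)"] transports_emap[OF f', of "(a, s)" "(b, t)"] v that
    by simp_all
  have nv: "vmap (?n a) s = vmap (?n' a) s" if "a \<in> vset X" "s \<in> vset T" for a s
    using v that by (simp add: name_at_def)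
  have ne: "emap (?n a) (s, t) \<sqsubseteq> emap (?n' a) (s, t)"
    if "a \<in> vset X" "s \<in> vset T" "t \<in> vset T" for a s t
    using cmp_mono_left[OF unit_left_hom[OF assms(2,4) that] h h' e] that by (simp add: name_at_def)
  have ge: "emap (name_appointment V X T Y eX eT f) (a, b) \<sqsubseteq> emap (name_appointment V X T Y eX eT f') (a, b)"
    if a: "a \<in> vset X" and b: "b \<in> vset X" for a b
  proof -
    \<comment> \<open>Both tuples go into the same product, so the tupling depends on the components alone.\<close>
    have P: "pow_family T Y (?n a) (?n b) = pow_family T Y (?n' a) (?n' b)"
      using nv a b by (intro pow_family_cong)
    have "tuple V (vset T) (pow_family T Y (?n a) (?n b)) (eobj X a b)
          (\<lambda>s. emap f ((a, s), (b, s)) \<odot> unit_right V X eT a b s) \<sqsubseteq>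
        tuple V (vset T) (pow_family T Y (?n a) (?n b)) (eobj X a b)
          (\<lambda>s. emap f' ((a, s), (b, s)) \<odot> unit_right V X eT a b s)"
    proof (rule tuple_mono)
      show "is_product V (vset T) (pow_family T Y (?n a) (?n b))
          (prd V (vset T) (pow_family T Y (?n a) (?n b))) (prj V (vset T) (pow_family T Y (?n a) (?n b)))"
        by (rule has_powerD[OF assms(3) name_at_transports[OF assms(2,4) f a]
              name_at_transports[OF assms(2,4) f b]])
      show "eobj X a b \<in> obj V" by (rule is_vgraph_obj[OF assms(1) a b])
    next
      fix s assume s: "s \<in> vset T"
      show "emap f ((a, s), (b, s)) \<odot> unit_right V X eT a b s
          \<in> hom V (eobj X a b) (pow_family T Y (?n a) (?n b) s)"
        by (rule name_edge_family[OF assms(1,5) f a b s])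
      show "emap f' ((a, s), (b, s)) \<odot> unit_right V X eT a b s
          \<in> hom V (eobj X a b) (pow_family T Y (?n a) (?n b) s)"
        unfolding P by (rule name_edge_family[OF assms(1,5) f' a b s])
      show "emap f ((a, s), (b, s)) \<odot> unit_right V X eT a b s
          \<sqsubseteq> emap f' ((a, s), (b, s)) \<odot> unit_right V X eT a b s"
        by (rule cmp_mono_left[OF unit_right_hom[OF assms(1,5) a b s]
              h[OF a s b s] h'[OF a s b s] e[OF a s b s]])
    qed
    then show ?thesis using a b P by (simp add: name_appointment_def)
  qed
  show ?thesis
    unfolding power_transport_le_def using nv ne ge by (simp add: name_appointment_def)
qed

lemma realization_appointment_mono:
  assumes "is_vgraph V T" "has_power V T Y"
    and "contact_arrows V Y k"
    and g: "g \<in> transports V X (pgraph V T Y)" and g': "g' \<in> transports V X (pgraph V T Y)"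
    and "power_transport_le V X T g g'"
  shows "transport_le V (tgraph V X T)
    (realization_appointment V X T Y k g) (realization_appointment V X T Y k g')"
proof -
  have v: "vmap (vmap g a) s = vmap (vmap g' a) s" if "a \<in> vset X" "s \<in> vset T" for a s
    using assms(6) that by (simp add: power_transport_le_def)
  have e: "emap (vmap g a) (s, t) \<sqsubseteq> emap (vmap g' a) (s, t)"
    if "a \<in> vset X" "s \<in> vset T" "t \<in> vset T" for a s t
    using assms(6) that by (simp add: power_transport_le_def)
  have ga: "vmap g a \<in> transports V T Y" "vmap g' a \<in> transports V T Y" if "a \<in> vset X" for a
    using transports_vmap[OF g that] transports_vmap[OF g' that] by simp_all
  have edge: "emap (realization_appointment V X T Y k g) ((a, s), (b, t))
      \<sqsubseteq> emap (realization_appointment V X T Y k g') ((a, s), (b, t))"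
    if a: "a \<in> vset X" and s: "s \<in> vset T" and b: "b \<in> vset X" and t: "t \<in> vset T" for a s b t
  proof -
    have P: "pow_family T Y (vmap g' a) (vmap g' b) = pow_family T Y (vmap g a) (vmap g b)"
      using v a b by (intro pow_family_cong) auto
    have gab: "emap g (a, b) \<in> hom V (eobj X a b) (prd V (vset T) (pow_family T Y (vmap g a) (vmap g b)))"
      using transports_emap[OF g a b] by simp
    have gab': "emap g' (a, b) \<in> hom V (eobj X a b) (prd V (vset T) (pow_family T Y (vmap g a) (vmap g b)))"
      using transports_emap[OF g' a b] P by simp
    have le: "emap g (a, b) \<sqsubseteq> emap g' (a, b)"
      using assms(6) a b by (simp add: power_transport_le_def)
    show ?thesis
      unfolding realization_emap[OF assms(1-3) g a b s t] realization_emap[OF assms(1-3) g' a b s t]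
        v[OF a s, symmetric] v[OF b s, symmetric] v[OF b t, symmetric]
    proof (rule contact_mono[OF assms(3)])
      show "component V T Y (vmap g a) (vmap g b) s (emap g (a, b))
          \<sqsubseteq> component V T Y (vmap g' a) (vmap g' b) s (emap g' (a, b))"
        unfolding component_def P
        by (rule cmp_mono_right[OF gab gab' prj_hom[OF assms(2) ga(1)[OF a] ga(1)[OF b] s] le])
      show "emap (vmap g b) (s, t) \<sqsubseteq> emap (vmap g' b) (s, t)" by (rule e[OF b s t])
      show "emap (vmap g' b) (s, t) \<in> hom V (eobj T s t) (eobj Y (vmap (vmap g b) s) (vmap (vmap g b) t))"
        using transports_emap[OF ga(2)[OF b] s t] v b s t by simp
      show "component V T Y (vmap g' a) (vmap g' b) s (emap g' (a, b))
          \<in> hom V (eobj X a b) (eobj Y (vmap (vmap g a) s) (vmap (vmap g b) s))"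
        using component_emap_hom[OF assms(2) g' a b s] v a b s by simp
    qed (use component_emap_hom[OF assms(2) g a b s] transports_emap[OF ga(1)[OF b] s t]
          transports_vmap[OF ga(1)] a b s t in auto)
  qed
  show ?thesis
    unfolding transport_le_def using v edge realization_vmap[OF g] realization_vmap[OF g'] by auto
qed


section \<open>The two round trips\<close>

lemma component_name_appointment:
  assumes "is_vgraph V X" "is_vgraph V T" "has_power V T Y"
    and "unit_arrows V X eX" "unit_arrows V T eT" "f \<in> transports V (tgraph V X T) Y"
    and "a \<in> vset X" "b \<in> vset X" "s \<in> vset T"
  shows "component V T Y (name_at V T eX f a) (name_at V T eX f b) s
      (emap (name_appointment V X T Y eX eT f) (a, b)) =
    emap f ((a, s), (b, s)) \<odot> unit_right V X eT a b s"
  using prj_tuple[OF has_powerD[OF assms(3) name_at_transports[OF assms(2,4,6,7)]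
        name_at_transports[OF assms(2,4,6,8)]] is_vgraph_obj[OF assms(1,7,8)]
      name_edge_family[OF assms(1,5-8)] assms(9)] assms(7,8)
  by (simp add: component_def name_appointment_def)

text \<open>On vertexes the round trip is the identity, and its edge mappings are the composites that
  lower decomposability bounds by those of \<open>f\<close>.\<close>

lemma realization_name_le:
  assumes "is_vgraph V X" "is_vgraph V T" "has_power V T Y"
    and "unit_arrows V X eX" "unit_arrows V T eT" "contact_arrows V Y k"
    and "f \<in> lower_decomposable V X T Y eX eT k"
  shows "transport_le V (tgraph V X T)
    (realization_appointment V X T Y k (name_appointment V X T Y eX eT f)) f"
proof -
  have f: "f \<in> transports V (tgraph V X T) Y" using assms(7) by (simp add: lower_decomposable_def)
  let ?g = "name_appointment V X T Y eX eT f"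
  have g: "?g \<in> transports V X (pgraph V T Y)" by (rule name_appointment_transports[OF assms(1-5) f])
  have n: "vmap ?g a = name_at V T eX f a" if "a \<in> vset X" for a
    using that by (simp add: name_appointment_def)
  have "emap (realization_appointment V X T Y k ?g) ((a, s), (b, t)) \<sqsubseteq> emap f ((a, s), (b, t))"
    if "a \<in> vset X" "s \<in> vset T" "b \<in> vset X" "t \<in> vset T" for a s b t
  proof -
    have "emap (realization_appointment V X T Y k ?g) ((a, s), (b, t)) =
      contact V k (vmap f (a, s)) (vmap f (b, s)) (vmap f (b, t))
         (emap f ((a, s), (b, s)) \<odot> unit_right V X eT a b s)
         (emap f ((b, s), (b, t)) \<odot> unit_left V T eX b s t)"
      using realization_emap[OF assms(2,3,6) g, of a b s t]
        component_name_appointment[OF assms(1-5) f, of a b s] that n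
      by (simp add: name_at_def)
    then show ?thesis using assms(7) that by (simp add: lower_decomposable_def)
  qed
  moreover have "vmap (realization_appointment V X T Y k ?g) (a, s) = vmap f (a, s)"
    if "a \<in> vset X" "s \<in> vset T" for a s
    using realization_vmap[OF g that] n that by (simp add: name_at_def)
  ultimately show ?thesis unfolding transport_le_def by auto
qed

text \<open>The first inequality of upper neutrality compares the edges in \<open>Y\<^sup>T\<close>, one component at a time
  by \<open>prod_mono\<close>; the second compares the edge mappings of the transports \<open>T \<Rightarrow> Y\<close> that are the
  values at vertexes.\<close>

lemma le_name_realization:
  assumes "is_vgraph V X" "is_vgraph V T" "has_power V T Y"
    and "unit_arrows V X eX" "unit_arrows V T eT" "contact_arrows V Y k"
    and "g \<in> upper_neutral V X T Y eX eT k"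
  shows "power_transport_le V X T g
    (name_appointment V X T Y eX eT (realization_appointment V X T Y k g))"
proof -
  let ?f = "realization_appointment V X T Y k g"
  let ?n = "name_at V T eX ?f"
  have g: "g \<in> transports V X (pgraph V T Y)" using assms(7) by (simp add: upper_neutral_def)
  have f: "?f \<in> transports V (tgraph V X T) Y"
    by (rule realization_appointment_transports[OF assms(2,3,6) g])
  have ga: "vmap g a \<in> transports V T Y" if "a \<in> vset X" for a
    using transports_vmap[OF g that] by simp
  have y: "vmap (vmap g a) s \<in> vset Y" if "a \<in> vset X" "s \<in> vset T" for a s
    by (rule transports_vmap[OF ga[OF that(1)] that(2)])
  have nv: "vmap (?n a) s = vmap (vmap g a) s" if "a \<in> vset X" "s \<in> vset T" for a s
    using realization_vmap[OF g that] that by (simp add: name_at_def)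
  have ne: "emap (vmap g a) (s, t) \<sqsubseteq> emap (?n a) (s, t)"
    if a: "a \<in> vset X" and s: "s \<in> vset T" and t: "t \<in> vset T" for a s t
  proof -
    have x: "eX a \<in> hom V \<star> (eobj X a a)" using assms(4) a by (simp add: unit_arrows_def)
    \<comment> \<open>Taking the component and precomposing with the unit commute.\<close>
    have c: "component V T Y (vmap g a) (vmap g a) s (emap g (a, a)) \<odot> eX a =
        component V T Y (vmap g a) (vmap g a) s (emap g (a, a) \<odot> eX a)"
      unfolding component_def
      using cmp_assoc[OF x transports_emap[OF g a a, simplified] prj_hom[OF assms(3) ga[OF a] ga[OF a] s]] .
    have "emap (?n a) (s, t) = emap ?f ((a, s), (a, t)) \<odot> unit_left V T eX a s t"
      using s t by (simp add: name_at_def)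
    also have "\<dots> = contact V k (vmap (vmap g a) s) (vmap (vmap g a) s) (vmap (vmap g a) t)
          (component V T Y (vmap g a) (vmap g a) s (emap g (a, a) \<odot> eX a))
          (emap (vmap g a) (s, t)) \<odot> lun V (eobj T s t)"
      unfolding realization_emap[OF assms(2,3,6) g a a s t] c[symmetric]
      by (rule contact_unit_left[OF assms(2,4,6) y[OF a s] y[OF a s] y[OF a t] a s t
            component_emap_hom[OF assms(3) g a a s] transports_emap[OF ga[OF a] s t]])
    finally show ?thesis using assms(7) a s t by (simp add: upper_neutral_def)
  qed
  have ge: "emap g (a, b) \<sqsubseteq> emap (name_appointment V X T Y eX eT ?f) (a, b)"
    if a: "a \<in> vset X" and b: "b \<in> vset X" for a b
  proof -
    have P: "pow_family T Y (?n a) (?n b) = pow_family T Y (vmap g a) (vmap g b)"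
      using nv a b by (intro pow_family_cong)
    show ?thesis
    proof (rule prod_mono[OF has_powerD[OF assms(3) ga[OF a] ga[OF b]]])
      show "emap g (a, b) \<in> hom V (eobj X a b) (prd V (vset T) (pow_family T Y (vmap g a) (vmap g b)))"
        using transports_emap[OF g a b] by simp
      show "emap (name_appointment V X T Y eX eT ?f) (a, b)
          \<in> hom V (eobj X a b) (prd V (vset T) (pow_family T Y (vmap g a) (vmap g b)))"
        using transports_emap[OF name_appointment_transports[OF assms(1-5) f] a b] P a b
        by (simp add: name_appointment_def)
      fix s assume s: "s \<in> vset T"
      have "prj V (vset T) (pow_family T Y (vmap g a) (vmap g b)) s
            \<odot> emap (name_appointment V X T Y eX eT ?f) (a, b) =
          emap ?f ((a, s), (b, s)) \<odot> unit_right V X eT a b s"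
        using component_name_appointment[OF assms(1-5) f a b s] by (simp add: component_def P)
      also have "\<dots> = contact V k (vmap (vmap g a) s) (vmap (vmap g b) s) (vmap (vmap g b) s)
          (component V T Y (vmap g a) (vmap g b) s (emap g (a, b)))
          (emap (vmap g b) (s, s) \<odot> eT s) \<odot> run V (eobj X a b)"
        unfolding realization_emap[OF assms(2,3,6) g a b s s]
        by (rule contact_unit_right[OF assms(1,5,6) y[OF a s] y[OF b s] y[OF b s] a b s
              component_emap_hom[OF assms(3) g a b s] transports_emap[OF ga[OF b] s s]])
      finally show "prj V (vset T) (pow_family T Y (vmap g a) (vmap g b)) s \<odot> emap g (a, b)
          \<sqsubseteq> prj V (vset T) (pow_family T Y (vmap g a) (vmap g b)) s
            \<odot> emap (name_appointment V X T Y eX eT ?f) (a, b)"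
        using assms(7) a b s by (simp add: upper_neutral_def component_def)
    qed
  qed
  show ?thesis
    unfolding power_transport_le_def using nv ne ge by (simp add: name_appointment_def)
qed

end


section \<open>Name and realization as a joint pair\<close>

theorem proposition4:
  fixes V :: "('o, 'm, 't) vcat"
    and X :: "('x, 'o) vgraph"
    and T :: "('t, 'o) vgraph"
    and Y :: "('y, 'o) vgraph"
  assumes "ordered_tensor_category V"
    and "is_vgraph V X"
    and "is_vgraph V T"
    and "is_vgraph V Y"
    and "has_power V T Y"
  shows
    "(\<forall>eX eT. unit_arrows V X eX \<longrightarrow> unit_arrows V T eT \<longrightarrow>
        name_appointment V X T Y eX eT
          \<in> transports V (tgraph V X T) Y \<rightarrow> transports V X (pgraph V T Y))
     \<and>
     (\<forall>k. contact_arrows V Y k \<longrightarrow>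
        evaluation V T Y k \<in> transports V (tgraph V (pgraph V T Y) T) Y \<and>
        realization_appointment V X T Y k
          \<in> transports V X (pgraph V T Y) \<rightarrow> transports V (tgraph V X T) Y)
     \<and>
     (\<forall>eX eT k. unit_arrows V X eX \<longrightarrow> unit_arrows V T eT \<longrightarrow>
        contact_arrows V Y k \<longrightarrow> monotone_contact V Y k \<longrightarrow>
        monotone_on (transports V (tgraph V X T) Y)
          (transport_le V (tgraph V X T)) (power_transport_le V X T)
          (name_appointment V X T Y eX eT) \<and>
        monotone_on (transports V X (pgraph V T Y))
          (power_transport_le V X T) (transport_le V (tgraph V X T))
          (realization_appointment V X T Y k) \<and>
        (\<forall>f \<in> lower_decomposable V X T Y eX eT k.
           transport_le V (tgraph V X T)
             (realization_appointment V X T Y k (name_appointment V X T Y eX eT f)) f) \<and>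
        (\<forall>g \<in> upper_neutral V X T Y eX eT k.
           power_transport_le V X T g
             (name_appointment V X T Y eX eT (realization_appointment V X T Y k g))))"
proof -
  interpret ordered_tensor_category V by fact
  show ?thesis
    by (intro conjI allI impI ballI funcsetI monotone_onI)
      (use assms(2,3,5) in \<open>auto intro: name_appointment_transports evaluation_transports
        realization_appointment_transports name_appointment_mono realization_appointment_mono
        realization_name_le le_name_realization\<close>)
qed

end
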